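(* If there exists a matrix sequence $\{K_k,\ k=0,1,\dots\}$ such that the system $$x_{k+1}=(F_k+K_kH_k)x_k+G_kx_kw_k,\qquad k=0,1,2,\dots$$ is ESMS, then $(F_k,G_k|H_k)$ is $\mathcal K^{\infty}$-exactly detectable.
   Context: $\{w_k\}_{k\ge 0}$ is a one-dimensional independent white noise process on a probability space, with $E w_k=0$, $E[w_kw_j]=\delta_{kj}$; $\mathcal F_k=\sigma(w_0,\dots,w_k)$ and $\mathcal F_{-1}$ is the trivial sigma-algebra; $l^2_{\mathcal F_k}$ is the set of $\mathcal F_k$-measurable random vectors $x$ with $E\|x\|^2<\infty$. $(F_k,G_k|H_k)$ denotes the system $x_{k+1}=F_kx_k+G_kx_kw_k$, $y_k=H_kx_k$, $k=0,1,2,\dots$, with $x_k\in\mathbb R^n$, $y_k\in\mathbb R^m$ and $F_k,G_k\in\mathbb R^{n\times n}$, $H_k\in\mathbb R^{m\times n}$ deterministic real matrices; $K_k\in\mathbb R^{n\times m}$ are deterministic. ESMS (exponentially stable in mean square) for a linear system driven by $\{w_k\}$: there exist $\beta\ge 1$ and $\lambda\in(0,1)$ such that for any $0\le k_0\le k<+\infty$ and any state $x_{k_0}\in l^2_{\mathcal F_{k_0-1}}$ at time $k_0$, the trajectory started from $x_{k_0}$ satisfies $E\|x_k\|^2\le\beta E\|x_{k_0}\|^2\lambda^{k-k_0}$. A state $x_{k_0}\in l^2_{\mathcal F_{k_0-1}}$ at time $k_0$ is $k_0^\infty$-unobservable if the output generated from it satisfies $y_k=0$ a.s. for all $k\ge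 k_0$. The system is $k_0^\infty$-exactly detectable if there are constants $\beta\ge1$, $0<\lambda<1$ such that for every $k_0^\infty$-unobservable state $\xi$ the trajectory with $x_{k_0}=\xi$ satisfies $E\|x_k\|^2\le\beta E\|\xi\|^2\lambda^{k-k_0}$ for all $k\ge k_0$. The system is $\mathcal K^\infty$-exactly detectable if it is $k^\infty$-exactly detectable for every $k\ge0$. *)

theory Defs
  imports "HOL-Probability.Probability"
begin

locale white_noise = prob_space M for M :: "'a measure" +
  fixes w :: "nat \<Rightarrow> 'a \<Rightarrow> real"
  assumes indep: "indep_vars (\<lambda>_. borel) w UNIV"
    and square_integrable: "\<And>k. integrable M (\<lambda>\<omega>. (w k \<omega>)\<^sup>2)"
    and mean_zero: "\<And>k. expectation (w k) = 0"
    and covariance: "\<And>k j. expectation (\<lambda>\<omega>. w k \<omega> * w j \<omega>) = (if k = j then 1 else 0)"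

text \<open>The time index of the filtration is an integer, so that index \<open>-1\<close> gives the trivial
  sigma-algebra (generated by the empty family).\<close>

definition noise_filtration :: "'a measure \<Rightarrow> (nat \<Rightarrow> 'a \<Rightarrow> real) \<Rightarrow> int \<Rightarrow> 'a measure" where
  "noise_filtration M w k =
     sigma (space M) (\<Union>i\<in>{i. int i \<le> k}. {w i -` A \<inter> space M | A. A \<in> sets borel})"

definition l2_adapted ::
    "'a measure \<Rightarrow> (nat \<Rightarrow> 'a \<Rightarrow> real) \<Rightarrow> int \<Rightarrow> ('a \<Rightarrow> real ^ 'n) set" where
  "l2_adapted M w k =
     {x. x \<in> borel_measurable (noise_filtration M w k) \<and> integrable M (\<lambda>\<omega>. (norm (x \<omega>))\<^sup>2)}"

text \<open>\<open>trajectory F G w k0 \<xi> k\<close> is the state at time \<open>k\<close> of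
  \<open>x (k + 1) = F k x k + G k x k w k\<close> started from \<open>\<xi>\<close> at time \<open>k0\<close>. Only the times
  \<open>k \<ge> k0\<close> are meaningful; at earlier times the value is set to \<open>\<xi>\<close>.\<close>

primrec trajectory ::
    "(nat \<Rightarrow> real ^ 'n ^ 'n) \<Rightarrow> (nat \<Rightarrow> real ^ 'n ^ 'n) \<Rightarrow> (nat \<Rightarrow> 'a \<Rightarrow> real) \<Rightarrow>
     nat \<Rightarrow> ('a \<Rightarrow> real ^ 'n) \<Rightarrow> nat \<Rightarrow> 'a \<Rightarrow> real ^ 'n" where
  "trajectory F G w k0 \<xi> 0 = \<xi>"
| "trajectory F G w k0 \<xi> (Suc k) =
     (if k < k0 then \<xi>
      else (\<lambda>\<omega>. F k *v trajectory F G w k0 \<xi> k \<omega> +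
                w k \<omega> *\<^sub>R (G k *v trajectory F G w k0 \<xi> k \<omega>)))"

text \<open>Mean squares are Bochner integrals. For \<open>\<xi>\<close> in \<open>l2_adapted M w (int k0 - 1)\<close> they are genuine:
  the state at time \<open>k \<ge> k0\<close> is a function of \<open>\<xi>\<close> and \<open>w k0, \<dots>, w (k - 1)\<close>, hence independent of
  the square integrable \<open>w k\<close>, so every state is again square integrable.\<close>

definition ESMS ::
    "'a measure \<Rightarrow> (nat \<Rightarrow> 'a \<Rightarrow> real) \<Rightarrow> (nat \<Rightarrow> real ^ 'n ^ 'n) \<Rightarrow>
     (nat \<Rightarrow> real ^ 'n ^ 'n) \<Rightarrow> bool" where
  "ESMS M w F G \<longleftrightarrow>
     (\<exists>\<beta> \<rho>::real. \<beta> \<ge> 1 \<and> 0 < \<rho> \<and> \<rho> < 1 \<and>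
       (\<forall>k0 k. k0 \<le> k \<longrightarrow> (\<forall>\<xi> \<in> l2_adapted M w (int k0 - 1).
         (\<integral>\<omega>. (norm (trajectory F G w k0 \<xi> k \<omega>))\<^sup>2 \<partial>M)
           \<le> \<beta> * (\<integral>\<omega>. (norm (\<xi> \<omega>))\<^sup>2 \<partial>M) * \<rho> ^ (k - k0))))"

definition unobservable_state ::
    "'a measure \<Rightarrow> (nat \<Rightarrow> 'a \<Rightarrow> real) \<Rightarrow> (nat \<Rightarrow> real ^ 'n ^ 'n) \<Rightarrow>
     (nat \<Rightarrow> real ^ 'n ^ 'n) \<Rightarrow> (nat \<Rightarrow> real ^ 'n ^ 'm) \<Rightarrow> nat \<Rightarrow> ('a \<Rightarrow> real ^ 'n) \<Rightarrow> bool" where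
  "unobservable_state M w F G H k0 \<xi> \<longleftrightarrow>
     \<xi> \<in> l2_adapted M w (int k0 - 1) \<and>
     (\<forall>k \<ge> k0. AE \<omega> in M. H k *v trajectory F G w k0 \<xi> k \<omega> = 0)"

definition exactly_detectable_at ::
    "'a measure \<Rightarrow> (nat \<Rightarrow> 'a \<Rightarrow> real) \<Rightarrow> (nat \<Rightarrow> real ^ 'n ^ 'n) \<Rightarrow>
     (nat \<Rightarrow> real ^ 'n ^ 'n) \<Rightarrow> (nat \<Rightarrow> real ^ 'n ^ 'm) \<Rightarrow> nat \<Rightarrow> bool" where
  "exactly_detectable_at M w F G H k0 \<longleftrightarrow>
     (\<exists>\<beta> \<rho>::real. \<beta> \<ge> 1 \<and> 0 < \<rho> \<and> \<rho> < 1 \<and>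
       (\<forall>\<xi>. unobservable_state M w F G H k0 \<xi> \<longrightarrow>
         (\<forall>k \<ge> k0. (\<integral>\<omega>. (norm (trajectory F G w k0 \<xi> k \<omega>))\<^sup>2 \<partial>M)
           \<le> \<beta> * (\<integral>\<omega>. (norm (\<xi> \<omega>))\<^sup>2 \<partial>M) * \<rho> ^ (k - k0))))"

definition exactly_detectable ::
    "'a measure \<Rightarrow> (nat \<Rightarrow> 'a \<Rightarrow> real) \<Rightarrow> (nat \<Rightarrow> real ^ 'n ^ 'n) \<Rightarrow>
     (nat \<Rightarrow> real ^ 'n ^ 'n) \<Rightarrow> (nat \<Rightarrow> real ^ 'n ^ 'm) \<Rightarrow> bool" where
  "exactly_detectable M w F G H \<longleftrightarrow> (\<forall>k. exactly_detectable_at M w F G H k)"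

end

theory Submission imports Defs begin

text \<open>Output injection is invisible along an unobservable trajectory: if the output
  \<open>H k x k\<close> vanishes almost surely, then so does the correction \<open>K k H k x k\<close>, so the trajectory
  of the open system is almost surely equal to the closed-loop trajectory started from the same
  state (\<open>unobservable_trajectory_AE_eq\<close>). Mean squares do not distinguish functions that agree
  almost everywhere, hence the decay estimate of the closed loop is also one for the unobservable
  states of the open system, with the same constants \<open>\<beta>\<close> and \<open>\<rho>\<close> at every initial time. Since
  equality only almost everywhere is available, the transfer of the integrals needs the
  trajectories to be measurable.\<close>

lemma (in white_noise) noise_measurable: "w k \<in> borel_measurable M"
  using indep by (auto simp: indep_vars_def)

lemma (in white_noise) subalgebra_noise_filtration: "subalgebra M (noise_filtration M w k)"
proof -
  let ?E = "\<Union>i\<in>{i. int i \<le> k}. {w i -` A \<inter> space M | A. A \<in> sets borel}"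
  have "?E \<subseteq> sets M"
    using noise_measurable by (auto intro: measurable_sets)
  moreover have "?E \<subseteq> Pow (space M)"
    by auto
  ultimately show ?thesis
    unfolding subalgebra_def noise_filtration_def
    by (simp add: space_measure_of sets_measure_of sets.sigma_sets_subset)
qed

lemma (in white_noise) l2_adapted_measurable:
  "\<xi> \<in> l2_adapted M w k \<Longrightarrow> \<xi> \<in> borel_measurable M"
  using measurable_from_subalg[OF subalgebra_noise_filtration] by (auto simp: l2_adapted_def)

lemma (in white_noise) trajectory_measurable:
  fixes A G :: "nat \<Rightarrow> real ^ 'n ^ 'n"
  assumes "\<xi> \<in> borel_measurable M"
  shows "trajectory A G w k0 \<xi> k \<in> borel_measurable M"
proof (induction k)
  case 0
  then show ?case using assms by simp
next
  case (Suc k)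
  have "(\<lambda>\<omega>. B *v trajectory A G w k0 \<xi> k \<omega>) \<in> borel_measurable M" for B :: "real ^ 'n ^ 'n"
    using Suc.IH by (rule borel_measurable_continuous_on[rotated]) (intro continuous_intros)
  then show ?case
    using assms noise_measurable by simp
qed

text \<open>The closed-loop step differs from the open-loop one by \<open>K k\<close> applied to the output at time
  \<open>k\<close>. Each step discards one more null set, and only finitely many steps lead to time \<open>k\<close>.\<close>

lemma unobservable_trajectory_AE_eq:
  fixes F G :: "nat \<Rightarrow> real ^ 'n ^ 'n" and H :: "nat \<Rightarrow> real ^ 'n ^ 'm"
    and K :: "nat \<Rightarrow> real ^ 'm ^ 'n"
  assumes "unobservable_state M w F G H k0 \<xi>"
  shows "AE \<omega> in M. trajectory F G w k0 \<xi> k \<omega> =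
    trajectory (\<lambda>k. F k + K k ** H k) G w k0 \<xi> k \<omega>"
proof (induction k)
  case 0
  then show ?case by simp
next
  case (Suc k)
  show ?case
  proof (cases "k < k0")
    case True
    then show ?thesis by simp
  next
    case False
    then have "AE \<omega> in M. H k *v trajectory F G w k0 \<xi> k \<omega> = 0"
      using assms by (simp add: unobservable_state_def)
    with Suc.IH show ?thesis
    proof eventually_elim
      case (elim \<omega>)
      have "(F k + K k ** H k) *v trajectory F G w k0 \<xi> k \<omega> = F k *v trajectory F G w k0 \<xi> k \<omega>"
        using elim(2)
        by (simp add: matrix_vector_mult_add_rdistrib flip: matrix_vector_mul_assoc)
      then show ?case
        using False elim(1) by simp
    qed
  qed
qed

theorem proposition3p1p1:
  fixes M :: "'a measure" and w :: "nat \<Rightarrow> 'a \<Rightarrow> real"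
    and F G :: "nat \<Rightarrow> real ^ 'n ^ 'n" and H :: "nat \<Rightarrow> real ^ 'n ^ 'm"
  assumes "white_noise M w"
    and "\<exists>K :: nat \<Rightarrow> real ^ 'm ^ 'n. ESMS M w (\<lambda>k. F k + K k ** H k) G"
  shows "exactly_detectable M w F G H"
proof -
  interpret white_noise M w by (rule assms(1))
  obtain K :: "nat \<Rightarrow> real ^ 'm ^ 'n" where "ESMS M w (\<lambda>k. F k + K k ** H k) G"
    using assms(2) by blast
  then obtain \<beta> \<rho> :: real where const: "\<beta> \<ge> 1" "0 < \<rho>" "\<rho> < 1"
    and decay: "\<And>k0 k \<xi>. k0 \<le> k \<Longrightarrow> \<xi> \<in> l2_adapted M w (int k0 - 1) \<Longrightarrow>
      (\<integral>\<omega>. (norm (trajectory (\<lambda>k. F k + K k ** H k) G w k0 \<xi> k \<omega>))\<^sup>2 \<partial>M)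
        \<le> \<beta> * (\<integral>\<omega>. (norm (\<xi> \<omega>))\<^sup>2 \<partial>M) * \<rho> ^ (k - k0)"
    unfolding ESMS_def by blast
  have "(\<integral>\<omega>. (norm (trajectory F G w k0 \<xi> k \<omega>))\<^sup>2 \<partial>M)
      \<le> \<beta> * (\<integral>\<omega>. (norm (\<xi> \<omega>))\<^sup>2 \<partial>M) * \<rho> ^ (k - k0)"
    if unobs: "unobservable_state M w F G H k0 \<xi>" and "k0 \<le> k" for k0 k \<xi>
  proof -
    have adapted: "\<xi> \<in> l2_adapted M w (int k0 - 1)"
      using unobs by (simp add: unobservable_state_def)
    have [measurable]: "trajectory A G w k0 \<xi> k \<in> borel_measurable M" for A
      using adapted by (intro trajectory_measurable l2_adapted_measurable)
    have "(\<integral>\<omega>. (norm (trajectory F G w k0 \<xi> k \<omega>))\<^sup>2 \<partial>M) =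
        (\<integral>\<omega>. (norm (trajectory (\<lambda>k. F k + K k ** H k) G w k0 \<xi> k \<omega>))\<^sup>2 \<partial>M)"
      using unobservable_trajectory_AE_eq[OF unobs, of k K] by (intro integral_cong_AE) auto
    with decay[OF \<open>k0 \<le> k\<close> adapted] show ?thesis
      by simp
  qed
  with const show ?thesis
    unfolding exactly_detectable_def exactly_detectable_at_def by blast
qed

end
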